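(* Let $m\geqslant 1$ and $n\geqslant 3$ be integers, let $G$ be a subgroup of the symmetric group $\mathfrak{S}_m$, let $\chi$ be an irreducible (complex) character of $G$, and let $d_\chi^G$ be the associated generalized matrix function ($G$-immanant) on $m\times m$ complex matrices. Let $A_1,\ldots,A_n$ be $m\times m$ Hermitian positive semidefinite complex matrices, and for $k=1,\ldots,n$ let $$s_k := \sum_{1\leqslant i_1<i_2<\cdots<i_k\leqslant n} d_\chi^G(A_{i_1}+\cdots+A_{i_k}).$$ Then $$s_n + s_{n-2} + s_{n-4}+\cdots \ \geqslant\ s_{n-1}+s_{n-3}+s_{n-5}+\cdots,$$ where on each side the sum runs over all indices $k\geqslant 1$ of the indicated parity (that is, $k\equiv n\pmod 2$ with $1\leqslant k\leqslant n$ on the left, and $k\equiv n-1\pmod 2$ with $1\leqslant k\leqslant n-1$ on the right).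
   Context: For a subgroup $G$ of the symmetric group $\mathfrak{S}_m$ and an irreducible character $\chi$ of $G$, the $G$-immanant (generalized matrix function) of an $m\times m$ complex matrix $X=(x_{ij})$ is $d_\chi^G(X):=\sum_{\sigma\in G}\chi(\sigma)\prod_{i=1}^m x_{i,\sigma(i)}$. On Hermitian positive semidefinite matrices its values are real, so the inequality is one between real numbers. *)

theory Defs
  imports
    "HOL-Algebra.Sym_Groups"
    "Jordan_Normal_Form.Matrix"
    "Jordan_Normal_Form.VS_Connect"
    "Jordan_Normal_Form.Schur_Decomposition"
begin

section \<open>Irreducible complex characters\<close>

definition mat_trace :: "complex mat \<Rightarrow> complex" where
  "mat_trace X = (\<Sum>i<dim_row X. X $$ (i, i))"

text \<open>The target group is \<open>GL\<^sub>d\<close> over the complex numbers, i.e. the group of units of the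
  ring of \<open>d \<times> d\<close> matrices.\<close>

definition matrix_representation ::
  "('a, 'b) monoid_scheme \<Rightarrow> nat \<Rightarrow> ('a \<Rightarrow> complex mat) \<Rightarrow> bool" where
  "matrix_representation H d \<rho> \<longleftrightarrow> \<rho> \<in> hom H (units_of (ring_mat TYPE(complex) d ()))"

definition irreducible_representation ::
  "('a, 'b) monoid_scheme \<Rightarrow> nat \<Rightarrow> ('a \<Rightarrow> complex mat) \<Rightarrow> bool" where
  "irreducible_representation H d \<rho> \<longleftrightarrow>
     matrix_representation H d \<rho> \<and> d > 0 \<and>
     (\<forall>W. VectorSpace.subspace class_ring W (module_vec TYPE(complex) d) \<longrightarrow>
          (\<forall>g \<in> carrier H. \<forall>w \<in> W. \<rho> g *\<^sub>v w \<in> W) \<longrightarrow>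
          W = {0\<^sub>v d} \<or> W = carrier_vec d)"

text \<open>Only the values of \<open>\<chi>\<close> on the carrier of the group are constrained.\<close>

definition irreducible_character :: "('a, 'b) monoid_scheme \<Rightarrow> ('a \<Rightarrow> complex) \<Rightarrow> bool" where
  "irreducible_character H \<chi> \<longleftrightarrow>
     (\<exists>d \<rho>. irreducible_representation H d \<rho> \<and> (\<forall>g \<in> carrier H. \<chi> g = mat_trace (\<rho> g)))"

section \<open>Hermitian positive semidefinite matrices and generalized matrix functions\<close>

text \<open>The order on complex numbers is the one of \<^theory>\<open>HOL-Library.Complex_Order\<close>: \<open>0 \<le> z\<close>
  says that \<open>z\<close> is a nonnegative real, and \<open>w \<le> z\<close> that \<open>z - w\<close> is a nonnegative real.
  Hence \<open>w \<le> z\<close> is the usual inequality whenever \<open>w\<close> and \<open>z\<close> are real.\<close>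

definition hermitian_psd :: "nat \<Rightarrow> complex mat \<Rightarrow> bool" where
  "hermitian_psd m X \<longleftrightarrow>
     X \<in> carrier_mat m m \<and> mat_adjoint X = X \<and>
     (\<forall>v \<in> carrier_vec m. (X *\<^sub>v v) \<bullet>c v \<ge> 0)"

text \<open>The permutations in \<^const>\<open>sym_group\<close> act on \<open>{1..m}\<close>, whereas matrix
  indices start at \<open>0\<close>; hence the shift by one.\<close>

definition gen_matrix_function ::
  "nat \<Rightarrow> (nat \<Rightarrow> nat) set \<Rightarrow> ((nat \<Rightarrow> nat) \<Rightarrow> complex) \<Rightarrow> complex mat \<Rightarrow> complex" where
  "gen_matrix_function m G \<chi> X = (\<Sum>\<sigma>\<in>G. \<chi> \<sigma> * (\<Prod>i=1..m. X $$ (i - 1, \<sigma> i - 1)))"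

text \<open>Index tuples \<open>i\<^sub>1 < \<dots> < i\<^sub>k\<close> are represented by the \<open>k\<close>-element sets \<open>I\<close> of their entries.
  The type of matrices of arbitrary size has no zero, so \<open>\<Sum>i\<in>I. A i\<close> is taken
  in the additive group of \<open>m \<times> m\<close> matrices.\<close>

definition subset_sum_function ::
  "nat \<Rightarrow> (nat \<Rightarrow> nat) set \<Rightarrow> ((nat \<Rightarrow> nat) \<Rightarrow> complex) \<Rightarrow> nat \<Rightarrow> (nat \<Rightarrow> complex mat) \<Rightarrow> nat \<Rightarrow> complex"
  where
  "subset_sum_function m G \<chi> n A k =
     (\<Sum>I | I \<subseteq> {1..n} \<and> card I = k.
        gen_matrix_function m G \<chi> (finsum (module_mat TYPE(complex) m m) A I))"

end

theory Submission
  imports Defs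
begin

text \<open>The function \<open>d(X) = gen_matrix_function m G \<chi> X\<close> is multilinear in the rows of \<open>X\<close>. So
\<open>d (\<Sum>k\<in>I. A k)\<close> expands into terms \<open>g f\<close>, one for each map \<open>f\<close> from rows to \<open>I\<close>, where
\<open>g f = (\<Sum>\<sigma>\<in>G. \<chi> \<sigma> * (\<Prod>i. A\<^bsub>f i\<^esub>(i, \<sigma> i)))\<close>. The difference of the two sides of the inequality is
the sum of \<open>(-1)\<^bsup>n - card I\<^esup> d (\<Sum>k\<in>I. A k)\<close> over all \<open>I \<subseteq> {1..n}\<close>. Here \<open>I = {}\<close> may be
included because \<open>d 0 = 0\<close> when there is at least one row. By inclusion-exclusion only the maps
\<open>f\<close> onto \<open>{1..n}\<close> survive (\<open>alternating_sum_PiE\<close>).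

A single \<open>g f\<close> need not be real. But the set of surjections is invariant under precomposition with
elements of \<open>G\<close>, so the sum of all \<open>g f\<close> can be averaged over \<open>G\<close>, which turns it into
\<open>1 / card G\<close> times the sum of \<open>\<chi>(\<rho>\<tau>\<^bsup>-1\<^esup>) * (\<Prod>j. A\<^bsub>f j\<^esub>(\<tau> j, \<rho> j))\<close> over all surjections \<open>f\<close> and all
\<open>\<tau>, \<rho> \<in> G\<close>. For fixed \<open>f\<close> each factor is a positive semidefinite kernel in \<open>(\<tau>, \<rho>)\<close>: the entries of the matrices
\<open>A\<close> because these matrices are positive semidefinite, and \<open>\<chi>(\<rho>\<tau>\<^bsup>-1\<^esup>)\<close> because every finite-dimensional
representation of a finite group is unitary for a suitable inner product (\<open>pos_kernel_character\<close>).
By the Schur product theorem (\<open>pos_kernel_mult\<close>) the product is positive semidefinite too, so the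
sum of its values over all \<open>(\<tau>, \<rho>)\<close> is a nonnegative real (\<open>sum_positive_definite_function_nonneg\<close>).\<close>

section \<open>Positive semidefinite kernels\<close>

text \<open>Kernels on an arbitrary index set are more convenient here than matrices, since the index sets in
use are rows, pairs of rows, and group elements. With the order on the complex numbers, the single
condition \<open>0 \<le> _\<close> also forces the kernel to be Hermitian (\<open>pos_kernel_hermitian\<close>).\<close>

definition pos_kernel :: "'a set \<Rightarrow> ('a \<Rightarrow> 'a \<Rightarrow> complex) \<Rightarrow> bool" where
  "pos_kernel S K \<longleftrightarrow> (\<forall>c. 0 \<le> (\<Sum>a\<in>S. \<Sum>b\<in>S. cnj (c a) * c b * K a b))"

lemma pos_kernelD: "pos_kernel S K \<Longrightarrow> 0 \<le> (\<Sum>a\<in>S. \<Sum>b\<in>S. cnj (c a) * c b * K a b)"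
  by (simp add: pos_kernel_def)

lemma pos_kernel_eqI:
  assumes "pos_kernel S K" "\<And>a b. a \<in> S \<Longrightarrow> b \<in> S \<Longrightarrow> K a b = L a b"
  shows "pos_kernel S L"
  using assms by (simp add: pos_kernel_def cong: sum.cong)

lemma cnj_mult_self_nonneg: "0 \<le> cnj z * (z :: complex)"
  by (simp add: less_eq_complex_def)

text \<open>The form of the pulled-back kernel at \<open>c\<close> is the form of \<open>K\<close> at \<open>\<lambda>a. \<Sum>x\<in>T. c x * w x a\<close>: this is
the congruence \<open>W\<^sup>* K W\<close> for a possibly rectangular \<open>W\<close>.\<close>

lemma pos_kernel_pullback:
  assumes "pos_kernel S K"
  shows "pos_kernel T (\<lambda>x y. \<Sum>a\<in>S. \<Sum>b\<in>S. cnj (w x a) * w y b * K a b)"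
  unfolding pos_kernel_def
proof
  fix c :: "'b \<Rightarrow> complex"
  let ?d = "\<lambda>a. \<Sum>x\<in>T. c x * w x a"
  have "(\<Sum>x\<in>T. \<Sum>y\<in>T. cnj (c x) * c y * (\<Sum>a\<in>S. \<Sum>b\<in>S. cnj (w x a) * w y b * K a b))
      = (\<Sum>x\<in>T. \<Sum>y\<in>T. \<Sum>a\<in>S. \<Sum>b\<in>S. cnj (c x * w x a) * (c y * w y b) * K a b)"
    by (simp add: sum_distrib_left mult_ac)
  also have "\<dots> = (\<Sum>x\<in>T. \<Sum>a\<in>S. \<Sum>y\<in>T. \<Sum>b\<in>S. cnj (c x * w x a) * (c y * w y b) * K a b)"
    by (intro sum.cong refl sum.swap)
  also have "\<dots> = (\<Sum>a\<in>S. \<Sum>x\<in>T. \<Sum>b\<in>S. \<Sum>y\<in>T. cnj (c x * w x a) * (c y * w y b) * K a b)"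
    by (subst sum.swap) (intro sum.cong refl sum.swap)
  also have "\<dots> = (\<Sum>a\<in>S. \<Sum>b\<in>S. \<Sum>x\<in>T. \<Sum>y\<in>T. cnj (c x * w x a) * (c y * w y b) * K a b)"
    by (intro sum.cong refl sum.swap)
  also have "\<dots> = (\<Sum>a\<in>S. \<Sum>b\<in>S. cnj (?d a) * ?d b * K a b)"
    by (simp add: sum_distrib_left sum_distrib_right mult.assoc)
      (intro sum.cong refl sum.swap)
  also have "\<dots> \<ge> 0"
    by (rule pos_kernelD[OF assms])
  finally show "0 \<le> (\<Sum>x\<in>T. \<Sum>y\<in>T. cnj (c x) * c y * (\<Sum>a\<in>S. \<Sum>b\<in>S. cnj (w x a) * w y b * K a b))" .
qed

lemma pos_kernel_comp:
  assumes "pos_kernel S K" "finite S" "\<And>x. x \<in> T \<Longrightarrow> h x \<in> S"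
  shows "pos_kernel T (\<lambda>x y. K (h x) (h y))"
proof -
  let ?w = "\<lambda>x a. if a = h x then 1 else (0 :: complex)"
  have "(\<Sum>a\<in>S. \<Sum>b\<in>S. cnj (?w x a) * ?w y b * K a b) = K (h x) (h y)"
    if "x \<in> T" "y \<in> T" for x y
  proof -
    have "(\<Sum>a\<in>S. \<Sum>b\<in>S. cnj (?w x a) * ?w y b * K a b)
        = (\<Sum>a\<in>S. if a = h x then (\<Sum>b\<in>S. if b = h y then K a b else 0) else 0)"
      by (intro sum.cong refl) (auto intro!: sum.cong)
    then show ?thesis
      using assms that by simp
  qed
  then show ?thesis
    by (rule pos_kernel_eqI[OF pos_kernel_pullback[OF assms(1)]])
qed

lemma pos_kernel_subset:
  "pos_kernel S K \<Longrightarrow> finite S \<Longrightarrow> T \<subseteq> S \<Longrightarrow> pos_kernel T K"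
  using pos_kernel_comp[of S K T "\<lambda>x. x"] by auto

lemma pos_kernel_diag:
  assumes "pos_kernel S K" "finite S" "a \<in> S"
  shows "0 \<le> K a a"
  using pos_kernelD[OF pos_kernel_subset[OF assms(1,2), of "{a}"], of "\<lambda>_. 1"] assms(3) by simp

lemma pos_kernel_pair:
  assumes "pos_kernel S K" "finite S" "a \<in> S" "b \<in> S" "a \<noteq> b"
  shows "0 \<le> K a a + t * K a b + cnj t * K b a + cnj t * t * K b b"
  using pos_kernelD[OF pos_kernel_subset[OF assms(1,2), of "{a, b}"],
      of "\<lambda>x. if x = a then 1 else t"] assms(3-5)
  by (simp add: add_ac)

text \<open>The form at \<open>e\<^sub>a + t e\<^sub>b\<close> is real; taking \<open>t = 1\<close> and \<open>t = \<i>\<close> determines the imaginary and the real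
part of \<open>K b a\<close> from those of \<open>K a b\<close>.\<close>

lemma pos_kernel_hermitian:
  assumes "pos_kernel S K" "finite S" "a \<in> S" "b \<in> S"
  shows "K b a = cnj (K a b)"
proof (cases "a = b")
  case True
  then show ?thesis
    using pos_kernel_diag[OF assms(1-3)] by (simp add: complex_eq_iff less_eq_complex_def)
next
  case False
  note pair = pos_kernel_pair[OF assms False]
  have "Im (K a a) = 0" "Im (K b b) = 0"
    using pos_kernel_diag[OF assms(1,2)] assms(3,4) by (simp_all add: less_eq_complex_def)
  then show ?thesis
    using pair[of 1] pair[of \<i>] by (simp add: complex_eq_iff less_eq_complex_def)
qed

text \<open>If \<open>K x x = 0\<close>, the form at \<open>e\<^sub>b + t e\<^sub>x\<close> is affine in \<open>t\<close> over the reals, and it stays nonnegative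
only if its linear part vanishes.\<close>

lemma pos_kernel_null_row:
  assumes "pos_kernel S K" "finite S" "x \<in> S" "b \<in> S" "K x x = 0"
  shows "K x b = 0"
proof (rule ccontr)
  assume nz: "K x b \<noteq> 0"
  with assms(5) have "x \<noteq> b" by auto
  let ?z = "K b x"
  have zz: "K x b = cnj ?z"
    using pos_kernel_hermitian[OF assms(1,2,4,3)] .
  with nz have n0: "cmod ?z \<noteq> 0" by simp
  \<comment> \<open>With this factor the form at \<open>e\<^sub>b + t e\<^sub>x\<close> is \<open>K b b - 2 (K b b + 1) < 0\<close>.\<close>
  define r where "r = (Re (K b b) + 1) / (cmod ?z)\<^sup>2"
  let ?t = "- (of_real r * cnj ?z)"
  have "0 \<le> K b b + ?t * ?z + cnj ?t * cnj ?z"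
    using pos_kernel_pair[OF assms(1,2,4,3), of ?t] \<open>x \<noteq> b\<close> assms(5) zz by simp
  then have "0 \<le> Re (K b b) - 2 * (r * (cmod ?z)\<^sup>2)"
    unfolding cmod_power2 by (simp add: less_eq_complex_def power2_eq_square algebra_simps)
  moreover have "r * (cmod ?z)\<^sup>2 = Re (K b b) + 1"
    using n0 by (simp add: r_def)
  moreover have "0 \<le> Re (K b b)"
    using pos_kernel_diag[OF assms(1,2,4)] by (simp add: less_eq_complex_def)
  ultimately show False by simp
qed

text \<open>Completing the square: if \<open>K x x > 0\<close>, the form of the Schur complement at \<open>c\<close> is the minimum of
the form of \<open>K\<close> over all extensions of \<open>c\<close> to \<open>x\<close>. If \<open>K x x = 0\<close>, then division by zero makes the correction term
vanish, and the statement reduces to restriction.\<close>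

lemma pos_kernel_schur_complement:
  assumes "pos_kernel (insert x S) K" "finite S" "x \<notin> S"
  shows "pos_kernel S (\<lambda>a b. K a b - K a x * K x b / K x x)"
proof (cases "K x x = 0")
  case True
  then show ?thesis
    using pos_kernel_subset[OF assms(1), of S] assms(2) by auto
next
  case False
  show ?thesis
    unfolding pos_kernel_def
  proof
    fix c :: "'a \<Rightarrow> complex"
    let ?r = "\<Sum>b\<in>S. c b * K x b"
    let ?l = "\<Sum>a\<in>S. cnj (c a) * K a x"
    \<comment> \<open>\<open>t\<close> is the minimizing value of the extension at \<open>x\<close>.\<close>
    define t where "t = - ?r / K x x"
    define e where "e = (\<lambda>a. if a = x then t else c a)"
    have herm: "K a x = cnj (K x a)" if "a \<in> insert x S" for a
      using pos_kernel_hermitian[OF assms(1), of x a] assms(2) that by auto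
    have l: "?l = cnj ?r"
      by (simp add: herm)
    have kx: "cnj (K x x) = K x x"
      using herm[of x] by simp
    have e: "e x = t" "\<And>a. a \<in> S \<Longrightarrow> e a = c a"
      using assms(3) by (auto simp: e_def)
    have "0 \<le> (\<Sum>a\<in>insert x S. \<Sum>b\<in>insert x S. cnj (e a) * e b * K a b)"
      by (rule pos_kernelD[OF assms(1)])
    also have "\<dots> = cnj t * t * K x x + cnj t * ?r + t * ?l
        + (\<Sum>a\<in>S. \<Sum>b\<in>S. cnj (c a) * c b * K a b)"
      using assms(2,3) by (simp add: e sum.distrib sum_distrib_left mult_ac)
    also have "cnj t * t * K x x + cnj t * ?r + t * ?l = - (?l * ?r / K x x)"
      using False by (simp add: t_def l kx)
    also have "- (?l * ?r / K x x) + (\<Sum>a\<in>S. \<Sum>b\<in>S. cnj (c a) * c b * K a b)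
        = (\<Sum>a\<in>S. \<Sum>b\<in>S. cnj (c a) * c b * (K a b - K a x * K x b / K x x))"
      by (simp add: sum_product sum_divide_distrib sum_subtractf right_diff_distrib mult_ac)
        (rule sum.swap)
    finally show "0 \<le> \<dots>" .
  qed
qed

text \<open>A Cholesky decomposition: one step splits off the rank-one kernel \<open>K a x * K x b / K x x\<close> and leaves
the Schur complement, which has a decomposition by induction. The rank-one part and the Schur
complement together also reproduce the row and column of \<open>x\<close>, even when \<open>K x x = 0\<close>, because then
that row and column are zero.\<close>

lemma pos_kernel_gram:
  assumes "finite S" "pos_kernel S K"
  shows "\<exists>F :: 'a \<Rightarrow> 'a \<Rightarrow> complex. \<forall>a\<in>S. \<forall>b\<in>S. K a b = (\<Sum>p\<in>S. F p a * cnj (F p b))"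
  using assms
proof (induction S arbitrary: K rule: finite_induct)
  case empty
  then show ?case by simp
next
  case (insert x S)
  let ?L = "\<lambda>a b. K a b - K a x * K x b / K x x"
  have fin: "finite (insert x S)" using insert.hyps by simp
  obtain F where F: "\<And>a b. a \<in> S \<Longrightarrow> b \<in> S \<Longrightarrow> ?L a b = (\<Sum>p\<in>S. F p a * cnj (F p b))"
    using insert.IH[OF pos_kernel_schur_complement[OF insert.prems insert.hyps]] by blast
  define q where "q = complex_of_real (sqrt (Re (K x x)))"
  define F' where "F' = (\<lambda>p a. if p = x then K a x / q else if a = x then 0 else F p a)"
  have kx: "0 \<le> K x x" using pos_kernel_diag[OF insert.prems fin] by simp
  have qq: "q * cnj q = K x x"
    using kx by (simp add: q_def less_eq_complex_def complex_eq_iff)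
  have herm: "cnj (K b x) = K x b" if "b \<in> insert x S" for b
    using pos_kernel_hermitian[OF insert.prems fin, of b x] that by simp
  have first: "F' x a * cnj (F' x b) = K a x * K x b / K x x" if "b \<in> insert x S" for a b
    using herm[OF that] by (simp add: F'_def flip: qq)
  have null: "K x b = 0" "K b x = 0" if "K x x = 0" "b \<in> insert x S" for b
    using pos_kernel_null_row[OF insert.prems fin _ that(2,1)] herm[OF that(2)] by simp_all
  have rest: "(\<Sum>p\<in>S. F' p a * cnj (F' p b)) = ?L a b"
    if "a \<in> insert x S" "b \<in> insert x S" for a b
  proof (cases "a = x \<or> b = x")
    case True
    then have "?L a b = 0"
      using null that by (cases "K x x = 0") auto
    moreover have "F' p a * cnj (F' p b) = 0" if "p \<in> S" for p
      using True that insert.hyps by (auto simp: F'_def)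
    ultimately show ?thesis by simp
  next
    case False
    with that have "?L a b = (\<Sum>p\<in>S. F p a * cnj (F p b))" by (intro F) auto
    also have "\<dots> = (\<Sum>p\<in>S. F' p a * cnj (F' p b))"
      using False insert.hyps by (intro sum.cong) (auto simp: F'_def)
    finally show ?thesis by simp
  qed
  show ?case
    using insert.hyps first rest by (intro exI[of _ F']) auto
qed

lemma pos_kernel_sum:
  assumes "\<And>p. p \<in> P \<Longrightarrow> pos_kernel S (K p)"
  shows "pos_kernel S (\<lambda>a b. \<Sum>p\<in>P. K p a b)"
  unfolding pos_kernel_def
proof
  fix c :: "'b \<Rightarrow> complex"
  have "(\<Sum>a\<in>S. \<Sum>b\<in>S. cnj (c a) * c b * (\<Sum>p\<in>P. K p a b))
      = (\<Sum>p\<in>P. \<Sum>a\<in>S. \<Sum>b\<in>S. cnj (c a) * c b * K p a b)"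
    by (simp add: sum_distrib_left sum.swap[where B = P])
  also have "\<dots> \<ge> 0"
    using assms by (intro sum_nonneg pos_kernelD)
  finally show "0 \<le> (\<Sum>a\<in>S. \<Sum>b\<in>S. cnj (c a) * c b * (\<Sum>p\<in>P. K p a b))" .
qed

lemma pos_kernel_scale:
  assumes "pos_kernel S K"
  shows "pos_kernel S (\<lambda>a b. f a * cnj (f b) * K a b)"
  unfolding pos_kernel_def
proof
  fix c :: "'a \<Rightarrow> complex"
  show "0 \<le> (\<Sum>a\<in>S. \<Sum>b\<in>S. cnj (c a) * c b * (f a * cnj (f b) * K a b))"
    using pos_kernelD[OF assms, of "\<lambda>a. c a * cnj (f a)"] by (simp add: mult_ac)
qed

text \<open>The Schur product theorem. A Gram decomposition of \<open>K\<close> writes the product as a sum of kernels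
congruent to \<open>L\<close> by diagonal matrices.\<close>

lemma pos_kernel_mult:
  assumes "finite S" "pos_kernel S K" "pos_kernel S L"
  shows "pos_kernel S (\<lambda>a b. K a b * L a b)"
proof -
  obtain F where F: "\<And>a b. a \<in> S \<Longrightarrow> b \<in> S \<Longrightarrow> K a b = (\<Sum>p\<in>S. F p a * cnj (F p b))"
    using pos_kernel_gram[OF assms(1,2)] by blast
  have "pos_kernel S (\<lambda>a b. \<Sum>p\<in>S. F p a * cnj (F p b) * L a b)"
    by (intro pos_kernel_sum pos_kernel_scale assms)
  then show ?thesis
    by (rule pos_kernel_eqI) (simp add: F sum_distrib_right)
qed

lemma pos_kernel_one: "pos_kernel S (\<lambda>_ _. 1)"
  by (simp add: pos_kernel_def cnj_mult_self_nonneg flip: sum_product cnj_sum)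

lemma pos_kernel_prod:
  assumes "finite S" "\<And>j. j \<in> J \<Longrightarrow> pos_kernel S (K j)"
  shows "pos_kernel S (\<lambda>a b. \<Prod>j\<in>J. K j a b)"
  using assms(2)
proof (induction J rule: infinite_finite_induct)
  case (insert j J)
  then show ?case using pos_kernel_mult[OF assms(1)] by simp
qed (simp_all add: pos_kernel_one)

lemma pos_kernel_transpose:
  assumes "pos_kernel S K"
  shows "pos_kernel S (\<lambda>a b. K b a)"
  unfolding pos_kernel_def
proof
  fix c :: "'a \<Rightarrow> complex"
  show "0 \<le> (\<Sum>a\<in>S. \<Sum>b\<in>S. cnj (c a) * c b * K b a)"
    using pos_kernelD[OF assms, of "\<lambda>a. cnj (c a)"]
    by (subst sum.swap) (simp add: mult_ac)
qed

section \<open>Characters of finite groups are positive definite functions\<close>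

lemma mat_mult_entry:
  assumes "A \<in> carrier_mat n n" "B \<in> carrier_mat n n" "i < n" "j < n"
  shows "(A * B) $$ (i, j) = (\<Sum>k<n. A $$ (i, k) * B $$ (k, j))"
  using assms by (auto simp: scalar_prod_def lessThan_atLeast0)

lemma mat_mult3_entry:
  assumes "A \<in> carrier_mat n n" "B \<in> carrier_mat n n" "C \<in> carrier_mat n n" "i < n" "j < n"
  shows "(A * B * C) $$ (i, j) = (\<Sum>y<n. \<Sum>x<n. A $$ (i, x) * B $$ (x, y) * C $$ (y, j))"
proof -
  have "(A * B * C) $$ (i, j) = (\<Sum>y<n. (A * B) $$ (i, y) * C $$ (y, j))"
    using assms by (intro mat_mult_entry) auto
  also have "\<dots> = (\<Sum>y<n. \<Sum>x<n. A $$ (i, x) * B $$ (x, y) * C $$ (y, j))"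
    by (intro sum.cong refl) (simp add: mat_mult_entry[OF assms(1,2,4)] sum_distrib_right)
  finally show ?thesis .
qed

lemma matrix_representationD:
  assumes "group H" "matrix_representation H d \<rho>"
  shows "g \<in> carrier H \<Longrightarrow> \<rho> g \<in> carrier_mat d d"
    and "g \<in> carrier H \<Longrightarrow> g' \<in> carrier H \<Longrightarrow> \<rho> (g \<otimes>\<^bsub>H\<^esub> g') = \<rho> g * \<rho> g'"
    and "\<rho> \<one>\<^bsub>H\<^esub> = 1\<^sub>m d"
proof -
  let ?R = "ring_mat TYPE(complex) d ()"
  interpret R: ring ?R by (rule ring_mat)
  have hom: "\<rho> \<in> hom H (units_of ?R)"
    using assms(2) by (simp add: matrix_representation_def)
  show "g \<in> carrier H \<Longrightarrow> \<rho> g \<in> carrier_mat d d"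
    using hom_in_carrier[OF hom, of g] R.Units_closed[of "\<rho> g"]
    by (simp add: units_of_carrier ring_mat_simps)
  show "g \<in> carrier H \<Longrightarrow> g' \<in> carrier H \<Longrightarrow> \<rho> (g \<otimes>\<^bsub>H\<^esub> g') = \<rho> g * \<rho> g'"
    using hom_mult[OF hom, of g g'] by (simp add: units_of_mult ring_mat_simps)
  show "\<rho> \<one>\<^bsub>H\<^esub> = 1\<^sub>m d"
    using hom_one[OF hom assms(1) R.units_group] by (simp add: units_of_one ring_mat_simps)
qed

text \<open>With \<open>h q = 1\<close> the congruence \<open>q\<^sup>* h q = q\<^sup>*\<close> shows that the adjoint of \<open>q\<close> is positive; it is then
Hermitian and therefore equal to \<open>q\<close>.\<close>

lemma pos_kernel_inverse:
  fixes d :: nat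
  assumes h: "pos_kernel {..<d} h"
    and left: "\<And>a y. a < d \<Longrightarrow> y < d \<Longrightarrow> (\<Sum>b<d. h a b * q b y) = (if a = y then 1 else 0)"
  shows "pos_kernel {..<d} q"
proof -
  let ?L = "\<lambda>x y. cnj (q y x)"
  have "(\<Sum>a<d. \<Sum>b<d. cnj (q a x) * q b y * h a b) = ?L x y" if "x < d" "y < d" for x y
  proof -
    have "(\<Sum>a<d. \<Sum>b<d. cnj (q a x) * q b y * h a b)
        = (\<Sum>a<d. cnj (q a x) * (\<Sum>b<d. h a b * q b y))"
      by (simp add: sum_distrib_left mult_ac)
    also have "\<dots> = (\<Sum>a<d. if a = y then cnj (q a x) else 0)"
      using left[OF _ that(2)] by (intro sum.cong) auto
    finally show ?thesis using that by simp
  qed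
  then have L: "pos_kernel {..<d} ?L"
    by (intro pos_kernel_eqI[OF pos_kernel_pullback[OF h, of "{..<d}" "\<lambda>x a. q a x"]]) simp
  have "?L x y = q x y" if "x \<in> {..<d}" "y \<in> {..<d}" for x y
    using pos_kernel_hermitian[OF L, of y x] that by simp
  then show ?thesis by (rule pos_kernel_eqI[OF L])
qed

text \<open>Weyl's averaging. The matrix \<open>M = (\<Sum>g. \<rho>(g)\<^sup>* \<rho>(g))\<close> is positive definite and satisfies
\<open>\<rho>(t)\<^sup>* M \<rho>(t) = M\<close>. Hence \<open>\<rho>(t\<^bsup>-1\<^esup>) = M\<^bsup>-1\<^esup> \<rho>(t)\<^sup>* M\<close>, and the trace of
\<open>\<rho>(b) M\<^bsup>-1\<^esup> \<rho>(a)\<^sup>* M\<close> is the value at the pair of matrices \<open>\<rho>(a), \<rho>(b)\<close> of the form on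
\<open>d \<times> d\<close> matrices given by the tensor product of \<open>M\<close> with the transpose of \<open>M\<^bsup>-1\<^esup>\<close>. This tensor product
is a pointwise product of two positive kernels. Working with \<open>M\<close> and \<open>M\<^bsup>-1\<^esup>\<close> directly avoids
passing to an orthonormal basis.\<close>

lemma pos_kernel_character:
  assumes "group H" and fin: "finite (carrier H)" and rep: "matrix_representation H d \<rho>"
  shows "pos_kernel (carrier H) (\<lambda>a b. mat_trace (\<rho> (b \<otimes>\<^bsub>H\<^esub> inv\<^bsub>H\<^esub> a)))"
proof -
  interpret H: group H by fact
  note R = matrix_representationD[OF assms(1) rep]
  define r where "r g i j = \<rho> g $$ (i, j)" for g i j
  define h where "h i j = (\<Sum>g\<in>carrier H. \<Sum>k<d. cnj (r g k i) * r g k j)" for i j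
  define M where "M = mat d d (\<lambda>(i, j). h i j)"
  have M: "M \<in> carrier_mat d d" by (simp add: M_def)
  have h_pos: "pos_kernel {..<d} h"
    unfolding h_def
  proof (intro pos_kernel_sum)
    fix g k
    show "pos_kernel {..<d} (\<lambda>i j. cnj (r g k i) * r g k j)"
      using pos_kernel_scale[OF pos_kernel_one, of "{..<d}" "\<lambda>i. cnj (r g k i)"] by simp
  qed
  have r_mult: "r (a \<otimes>\<^bsub>H\<^esub> b) i j = (\<Sum>k<d. r a i k * r b k j)"
    if "a \<in> carrier H" "b \<in> carrier H" "i < d" "j < d" for a b i j
    using that by (simp add: r_def R(2) mat_mult_entry[OF R(1) R(1)])
  have h_form: "(\<Sum>a<d. \<Sum>b<d. cnj (u a) * h a b * v b)
      = (\<Sum>g\<in>carrier H. \<Sum>k<d. cnj (\<Sum>a<d. r g k a * u a) * (\<Sum>b<d. r g k b * v b))" for u v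
  proof -
    let ?t = "\<lambda>g k a b. cnj (r g k a * u a) * (r g k b * v b)"
    have "(\<Sum>a<d. \<Sum>b<d. cnj (u a) * h a b * v b)
        = (\<Sum>a<d. \<Sum>b<d. \<Sum>g\<in>carrier H. \<Sum>k<d. ?t g k a b)"
      by (simp add: h_def sum_distrib_left sum_distrib_right mult_ac)
    also have "\<dots> = (\<Sum>g\<in>carrier H. \<Sum>a<d. \<Sum>b<d. \<Sum>k<d. ?t g k a b)"
      by (simp only: sum.swap[where A = "{..<d}" and B = "carrier H"])
    also have "\<dots> = (\<Sum>g\<in>carrier H. \<Sum>a<d. \<Sum>k<d. \<Sum>b<d. ?t g k a b)"
      by (intro sum.cong refl sum.swap)
    also have "\<dots> = (\<Sum>g\<in>carrier H. \<Sum>k<d. \<Sum>a<d. \<Sum>b<d. ?t g k a b)"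
      by (intro sum.cong refl sum.swap)
    finally have "(\<Sum>a<d. \<Sum>b<d. cnj (u a) * h a b * v b)
        = (\<Sum>g\<in>carrier H. \<Sum>k<d. \<Sum>a<d. \<Sum>b<d. ?t g k a b)" .
    then show ?thesis by (simp add: sum_product)
  qed
  \<comment> \<open>If \<open>M v = 0\<close>, then every \<open>\<rho>(g) v\<close> vanishes, in particular \<open>v\<close> itself (take \<open>g = 1\<close>).\<close>
  have "det M \<noteq> 0"
  proof
    assume "det M = 0"
    then obtain v where v: "v \<in> carrier_vec d" "v \<noteq> 0\<^sub>v d" "M *\<^sub>v v = 0\<^sub>v d"
      using det_0_iff_vec_prod_zero_field[OF M] by blast
    have row: "(\<Sum>b<d. h a b * v $ b) = 0" if "a < d" for a
    proof -
      have "(M *\<^sub>v v) $ a = (\<Sum>b<d. h a b * v $ b)"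
        using that v(1) by (auto simp: M_def scalar_prod_def lessThan_atLeast0)
      then show ?thesis using v(3) that by simp
    qed
    let ?w = "\<lambda>g k. \<Sum>a<d. r g k a * v $ a"
    have "(\<Sum>g\<in>carrier H. \<Sum>k<d. cnj (?w g k) * ?w g k)
        = (\<Sum>a<d. cnj (v $ a) * (\<Sum>b<d. h a b * v $ b))"
      unfolding h_form[symmetric] by (simp add: sum_distrib_left mult.assoc)
    also have "\<dots> = 0" using row by simp
    finally have sum0: "(\<Sum>g\<in>carrier H. \<Sum>k<d. cnj (?w g k) * ?w g k) = 0" .
    have "(\<Sum>k<d. cnj (?w \<one>\<^bsub>H\<^esub> k) * ?w \<one>\<^bsub>H\<^esub> k) = 0"
      by (rule sum_nonneg_0[OF fin _ sum0]) (intro sum_nonneg cnj_mult_self_nonneg H.one_closed)+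
    then have w0: "?w \<one>\<^bsub>H\<^esub> k = 0" if "k < d" for k
      using sum_nonneg_0[of "{..<d}" "\<lambda>k. cnj (?w \<one>\<^bsub>H\<^esub> k) * ?w \<one>\<^bsub>H\<^esub> k" k]
        that by (simp add: cnj_mult_self_nonneg del: cnj_sum)
    have "v $ k = 0" if "k < d" for k
    proof -
      have "?w \<one>\<^bsub>H\<^esub> k = (\<Sum>a<d. if a = k then v $ a else 0)"
        using that by (intro sum.cong) (auto simp: r_def R(3))
      with w0[OF that] that show ?thesis by simp
    qed
    then have "v = 0\<^sub>v d" using v(1) by (intro eq_vecI) auto
    with v(2) show False ..
  qed
  then have "M \<in> Units (ring_mat TYPE(complex) d ())"
    by (rule det_non_zero_imp_unit[OF M])
  then obtain Q where Q: "Q \<in> carrier_mat d d" "M * Q = 1\<^sub>m d" "Q * M = 1\<^sub>m d"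
    unfolding Units_def by (auto simp: ring_mat_simps)
  define q where "q i j = Q $$ (i, j)" for i j
  have "(\<Sum>b<d. h a b * q b y) = (M * Q) $$ (a, y)" if "a < d" "y < d" for a y
    using mat_mult_entry[OF M Q(1) that] that by (simp add: M_def q_def)
  then have q_pos: "pos_kernel {..<d} q"
    by (intro pos_kernel_inverse[OF h_pos]) (simp add: Q(2))
  have inv_entry: "r (inv\<^bsub>H\<^esub> t) j i = (\<Sum>l<d. \<Sum>k<d. q j k * cnj (r t l k) * h l i)"
    if t: "t \<in> carrier H" and ij: "i < d" "j < d" for t i j
  proof -
    define T where "T = mat d d (\<lambda>(k, l). cnj (r t l k))"
    have T: "T \<in> carrier_mat d d" by (simp add: T_def)
    have inv: "\<rho> (inv\<^bsub>H\<^esub> t) \<in> carrier_mat d d" using R(1) t by simp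
    have tinv: "\<rho> t * \<rho> (inv\<^bsub>H\<^esub> t) = 1\<^sub>m d"
      using R(2)[of t "inv\<^bsub>H\<^esub> t"] R(3) t by simp
    have "T * M * \<rho> t = M"
    proof (rule eq_matI)
      fix a b assume "a < dim_row M" "b < dim_col M"
      then have ab: "a < d" "b < d" using M by auto
      have "(T * M * \<rho> t) $$ (a, b) = (\<Sum>y<d. \<Sum>x<d. T $$ (a, x) * M $$ (x, y) * \<rho> t $$ (y, b))"
        by (rule mat_mult3_entry[OF T M R(1)[OF t] ab])
      also have "\<dots> = (\<Sum>x<d. \<Sum>y<d. cnj (r t x a) * h x y * r t y b)"
        using ab by (subst sum.swap) (simp add: T_def M_def r_def)
      also have "\<dots> = (\<Sum>g\<in>carrier H. \<Sum>k<d. cnj (r (g \<otimes>\<^bsub>H\<^esub> t) k a) * r (g \<otimes>\<^bsub>H\<^esub> t) k b)"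
        unfolding h_form using ab t by (intro sum.cong refl) (simp add: r_mult)
      also have "\<dots> = h a b"
        unfolding h_def
        by (rule sum.reindex_bij_witness[of _ "\<lambda>g. g \<otimes>\<^bsub>H\<^esub> inv\<^bsub>H\<^esub> t" "\<lambda>g. g \<otimes>\<^bsub>H\<^esub> t"])
          (use t in \<open>simp_all add: H.m_assoc\<close>)
      finally show "(T * M * \<rho> t) $$ (a, b) = M $$ (a, b)" using ab by (simp add: M_def)
    qed (use M T R(1)[OF t] in auto)
    moreover have TM: "T * M \<in> carrier_mat d d" using T M by simp
    ultimately have "T * M = M * \<rho> (inv\<^bsub>H\<^esub> t)"
      using assoc_mult_mat[OF TM R(1)[OF t] inv] right_mult_one_mat[OF TM] tinv by simp
    then have "Q * T * M = (Q * M) * \<rho> (inv\<^bsub>H\<^esub> t)"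
      using assoc_mult_mat[OF Q(1) T M] assoc_mult_mat[OF Q(1) M inv] by simp
    then have "\<rho> (inv\<^bsub>H\<^esub> t) = Q * T * M"
      using Q(3) inv by simp
    then have "r (inv\<^bsub>H\<^esub> t) j i = (\<Sum>l<d. \<Sum>k<d. Q $$ (j, k) * T $$ (k, l) * M $$ (l, i))"
      using mat_mult3_entry[OF Q(1) T M ij(2,1)] by (simp add: r_def)
    then show ?thesis
      using ij by (simp add: q_def T_def M_def)
  qed
  let ?P = "{..<d} \<times> {..<d}"
  have "pos_kernel ?P (\<lambda>x y. h (fst x) (fst y) * q (snd y) (snd x))"
    by (intro pos_kernel_mult pos_kernel_comp[OF h_pos]
        pos_kernel_comp[OF pos_kernel_transpose[OF q_pos]]) auto
  from pos_kernel_pullback[OF this, of "carrier H" "\<lambda>g x. r g (fst x) (snd x)"]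
  have "pos_kernel (carrier H) (\<lambda>a b. \<Sum>x\<in>?P. \<Sum>y\<in>?P.
      cnj (r a (fst x) (snd x)) * r b (fst y) (snd y) * (h (fst x) (fst y) * q (snd y) (snd x)))" .
  moreover have "(\<Sum>x\<in>?P. \<Sum>y\<in>?P.
      cnj (r a (fst x) (snd x)) * r b (fst y) (snd y) * (h (fst x) (fst y) * q (snd y) (snd x)))
      = mat_trace (\<rho> (b \<otimes>\<^bsub>H\<^esub> inv\<^bsub>H\<^esub> a))" if ab: "a \<in> carrier H" "b \<in> carrier H" for a b
  proof -
    have "mat_trace (\<rho> (b \<otimes>\<^bsub>H\<^esub> inv\<^bsub>H\<^esub> a)) = (\<Sum>i<d. r (b \<otimes>\<^bsub>H\<^esub> inv\<^bsub>H\<^esub> a) i i)"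
      using R(1)[of "b \<otimes>\<^bsub>H\<^esub> inv\<^bsub>H\<^esub> a"] ab by (simp add: mat_trace_def r_def)
    also have "\<dots> = (\<Sum>i<d. \<Sum>j<d. r b i j * r (inv\<^bsub>H\<^esub> a) j i)"
      using ab by (simp add: r_mult)
    also have "\<dots> = (\<Sum>i<d. \<Sum>j<d. \<Sum>l<d. \<Sum>k<d. cnj (r a l k) * r b i j * (h l i * q j k))"
      using ab by (simp add: inv_entry sum_distrib_left mult_ac)
    also have "\<dots> = (\<Sum>y\<in>?P. \<Sum>x\<in>?P.
      cnj (r a (fst x) (snd x)) * r b (fst y) (snd y) * (h (fst x) (fst y) * q (snd y) (snd x)))"
      by (simp add: sum.cartesian_product')
    also have "\<dots> = (\<Sum>x\<in>?P. \<Sum>y\<in>?P.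
      cnj (r a (fst x) (snd x)) * r b (fst y) (snd y) * (h (fst x) (fst y) * q (snd y) (snd x)))"
      by (rule sum.swap)
    finally show ?thesis ..
  qed
  ultimately show ?thesis by (rule pos_kernel_eqI)
qed

lemma irreducible_character_pos_kernel:
  assumes G: "subgroup G (sym_group m)"
    and "irreducible_character ((sym_group m)\<lparr>carrier := G\<rparr>) \<chi>"
  shows "pos_kernel G (\<lambda>\<tau> \<rho>. \<chi> (\<rho> \<circ> inv' \<tau>))"
proof -
  let ?H = "(sym_group m)\<lparr>carrier := G\<rparr>"
  interpret S: group "sym_group m" by (rule sym_group_is_group)
  interpret H: group ?H by (rule subgroup.subgroup_is_group[OF G S.group_axioms])
  obtain d \<rho> where rep: "matrix_representation ?H d \<rho>"
    and tr: "\<And>g. g \<in> G \<Longrightarrow> \<chi> g = mat_trace (\<rho> g)"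
    using assms(2) by (auto simp: irreducible_character_def irreducible_representation_def)
  have perm: "G \<subseteq> carrier (sym_group m)"
    using subgroup.subset[OF G] .
  then have fin: "finite G"
    using finite_subset[OF _ finite_permutations[of "{1..m}"]] by (auto simp: sym_group_def)
  have "pos_kernel G (\<lambda>a b. mat_trace (\<rho> (b \<otimes>\<^bsub>?H\<^esub> inv\<^bsub>?H\<^esub> a)))"
    using pos_kernel_character[OF H.group_axioms _ rep] fin by simp
  moreover have "mat_trace (\<rho> (b \<otimes>\<^bsub>?H\<^esub> inv\<^bsub>?H\<^esub> a)) = \<chi> (b \<circ> inv' a)"
    if "a \<in> G" "b \<in> G" for a b
  proof -
    have "inv\<^bsub>?H\<^esub> a = inv' a"
      using S.m_inv_consistent[OF G that(1)] sym_group_inv_equality[of a m] perm that by auto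
    then have "b \<otimes>\<^bsub>?H\<^esub> inv\<^bsub>?H\<^esub> a = b \<circ> inv' a"
      by (simp add: sym_group_mult)
    moreover have "b \<otimes>\<^bsub>?H\<^esub> inv\<^bsub>?H\<^esub> a \<in> G"
      using that H.m_closed[of b "inv\<^bsub>?H\<^esub> a"] H.inv_closed[of a] by simp
    ultimately show ?thesis using tr by metis
  qed
  ultimately show ?thesis by (rule pos_kernel_eqI)
qed

section \<open>Averaging over the permutation group\<close>

lemma hermitian_psd_pos_kernel:
  assumes "hermitian_psd m X"
  shows "pos_kernel {1..m} (\<lambda>i j. X $$ (i - 1, j - 1))"
proof -
  have X: "X \<in> carrier_mat m m" and
    nonneg: "\<And>v. v \<in> carrier_vec m \<Longrightarrow> 0 \<le> (X *\<^sub>v v) \<bullet>c v"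
    using assms by (auto simp: hermitian_psd_def)
  have "pos_kernel {..<m} (\<lambda>i j. X $$ (i, j))"
    unfolding pos_kernel_def
  proof
    fix c :: "nat \<Rightarrow> complex"
    have "(X *\<^sub>v vec m c) \<bullet>c vec m c = (\<Sum>i<m. \<Sum>j<m. cnj (c i) * c j * X $$ (i, j))"
      using X by (auto simp: scalar_prod_def lessThan_atLeast0 sum_distrib_left mult_ac)
    then show "0 \<le> (\<Sum>i<m. \<Sum>j<m. cnj (c i) * c j * X $$ (i, j))"
      using nonneg[of "vec m c"] by simp
  qed
  then show ?thesis
    by (rule pos_kernel_comp[where h = "\<lambda>i. i - 1"]) auto
qed

text \<open>Substituting \<open>\<sigma> = \<rho> \<tau>\<^bsup>-1\<^esup>\<close>, \<open>i = \<tau> j\<close> and replacing \<open>f\<close> by \<open>f \<circ> \<tau>\<^bsup>-1\<^esup>\<close> does not change the sum, for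
any \<open>\<tau> \<in> G\<close>; adding these \<open>card G\<close> copies of it gives, for each \<open>f\<close>, the form of a positive kernel
at the constant function 1.\<close>

lemma sum_positive_definite_function_nonneg:
  assumes G: "subgroup G (sym_group m)"
    and \<chi>: "pos_kernel G (\<lambda>\<tau> \<rho>. \<chi> (\<rho> \<circ> inv' \<tau>))"
    and F: "finite F" "\<And>f \<tau>. f \<in> F \<Longrightarrow> \<tau> \<in> G \<Longrightarrow> f \<circ> \<tau> \<in> F"
    and K: "\<And>f j. f \<in> F \<Longrightarrow> j \<in> {1..m} \<Longrightarrow> pos_kernel {1..m} (K (f j))"
  shows "0 \<le> (\<Sum>f\<in>F. \<Sum>\<sigma>\<in>G. \<chi> \<sigma> * (\<Prod>i=1..m. K (f i) i (\<sigma> i)))"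
proof -
  interpret G: subgroup G "sym_group m" by fact
  interpret S: group "sym_group m" by (rule sym_group_is_group)
  have perm: "\<tau> permutes {1..m}" if "\<tau> \<in> G" for \<tau>
    using G.subset that by (auto simp: sym_group_carrier)
  have closed: "\<sigma> \<circ> \<tau> \<in> G" if "\<sigma> \<in> G" "\<tau> \<in> G" for \<sigma> \<tau>
    using G.m_closed[OF that] by (simp add: sym_group_mult)
  have inv_closed: "inv' \<tau> \<in> G" if "\<tau> \<in> G" for \<tau>
    using G.m_inv_closed[OF that] sym_group_inv_equality[of \<tau> m] G.subset that by auto
  have cancel: "(\<rho> \<circ> inv' \<tau>) \<circ> \<tau> = \<rho>" "(\<rho> \<circ> \<tau>) \<circ> inv' \<tau> = \<rho>"
    if "\<tau> \<in> G" for \<rho> :: "nat \<Rightarrow> 'c" and \<tau>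
    using permutes_inv_o[OF perm[OF that]] by (simp_all add: comp_assoc)
  have fin: "finite G"
    using finite_subset[OF _ finite_permutations[of "{1..m}"]] perm by auto
  define s where "s = (\<Sum>f\<in>F. \<Sum>\<sigma>\<in>G. \<chi> \<sigma> * (\<Prod>i=1..m. K (f i) i (\<sigma> i)))"
  have shift: "s = (\<Sum>f\<in>F. \<Sum>\<rho>\<in>G. \<chi> (\<rho> \<circ> inv' \<tau>) * (\<Prod>j=1..m. K (f j) (\<tau> j) (\<rho> j)))"
    if \<tau>: "\<tau> \<in> G" for \<tau>
  proof -
    have sum_G: "(\<Sum>\<sigma>\<in>G. \<phi> \<sigma>) = (\<Sum>\<rho>\<in>G. \<phi> (\<rho> \<circ> inv' \<tau>))" for \<phi> :: "(nat \<Rightarrow> nat) \<Rightarrow> complex"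
      by (rule sum.reindex_bij_witness[of _ "\<lambda>\<rho>. \<rho> \<circ> inv' \<tau>" "\<lambda>\<sigma>. \<sigma> \<circ> \<tau>"])
        (simp_all only: cancel[OF \<tau>] closed inv_closed \<tau>)
    have sum_F: "(\<Sum>f\<in>F. \<phi> (f \<circ> \<tau>)) = (\<Sum>f\<in>F. \<phi> f)" for \<phi> :: "(nat \<Rightarrow> 'a) \<Rightarrow> complex"
      by (rule sum.reindex_bij_witness[of _ "\<lambda>f. f \<circ> inv' \<tau>" "\<lambda>f. f \<circ> \<tau>"])
        (simp_all only: cancel[OF \<tau>] F(2) inv_closed \<tau>)
    have prod_\<tau>: "(\<Prod>i=1..m. \<phi> i) = (\<Prod>j=1..m. \<phi> (\<tau> j))" for \<phi> :: "nat \<Rightarrow> complex"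
      using prod.permute[OF perm[OF \<tau>], of \<phi>] by (simp only: comp_def)
    have "s = (\<Sum>f\<in>F. \<Sum>\<rho>\<in>G. \<chi> (\<rho> \<circ> inv' \<tau>) * (\<Prod>i=1..m. K (f i) i ((\<rho> \<circ> inv' \<tau>) i)))"
      unfolding s_def by (intro sum.cong refl sum_G)
    also have "\<dots> = (\<Sum>f\<in>F. \<Sum>\<rho>\<in>G. \<chi> (\<rho> \<circ> inv' \<tau>)
        * (\<Prod>j=1..m. K ((f \<circ> \<tau>) j) (\<tau> j) (\<rho> j)))"
    proof (intro sum.cong refl arg_cong2[of _ _ _ _ "(*)"])
      fix f :: "nat \<Rightarrow> 'a" and \<rho> :: "nat \<Rightarrow> nat"
      show "(\<Prod>i=1..m. K (f i) i ((\<rho> \<circ> inv' \<tau>) i)) = (\<Prod>j=1..m. K ((f \<circ> \<tau>) j) (\<tau> j) (\<rho> j))"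
        by (subst prod_\<tau>) (simp only: comp_apply permutes_inverses(2)[OF perm[OF \<tau>]])
    qed
    also have "\<dots> = (\<Sum>f\<in>F. \<Sum>\<rho>\<in>G. \<chi> (\<rho> \<circ> inv' \<tau>) * (\<Prod>j=1..m. K (f j) (\<tau> j) (\<rho> j)))"
      by (rule sum_F)
    finally show ?thesis .
  qed
  have "of_nat (card G) * s
      = (\<Sum>\<tau>\<in>G. \<Sum>f\<in>F. \<Sum>\<rho>\<in>G. \<chi> (\<rho> \<circ> inv' \<tau>) * (\<Prod>j=1..m. K (f j) (\<tau> j) (\<rho> j)))"
    using shift by (simp flip: sum_constant)
  also have "\<dots> = (\<Sum>f\<in>F. \<Sum>\<tau>\<in>G. \<Sum>\<rho>\<in>G. \<chi> (\<rho> \<circ> inv' \<tau>) * (\<Prod>j=1..m. K (f j) (\<tau> j) (\<rho> j)))"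
    by (rule sum.swap)
  also have "\<dots> \<ge> 0"
  proof (rule sum_nonneg)
    fix f assume f: "f \<in> F"
    have "pos_kernel G (\<lambda>\<tau> \<rho>. \<chi> (\<rho> \<circ> inv' \<tau>) * (\<Prod>j=1..m. K (f j) (\<tau> j) (\<rho> j)))"
    proof (intro pos_kernel_mult[OF fin \<chi>] pos_kernel_prod[OF fin])
      fix j assume j: "j \<in> {1..m}"
      have "pos_kernel G (\<lambda>\<tau> \<rho>. K (f j) ((\<lambda>\<tau>. \<tau> j) \<tau>) ((\<lambda>\<tau>. \<tau> j) \<rho>))"
        by (rule pos_kernel_comp[OF K[OF f j]]) (use permutes_in_image[OF perm] j in auto)
      then show "pos_kernel G (\<lambda>\<tau> \<rho>. K (f j) (\<tau> j) (\<rho> j))" by simp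
    qed
    from pos_kernelD[OF this, of "\<lambda>_. 1"]
    show "0 \<le> (\<Sum>\<tau>\<in>G. \<Sum>\<rho>\<in>G. \<chi> (\<rho> \<circ> inv' \<tau>) * (\<Prod>j=1..m. K (f j) (\<tau> j) (\<rho> j)))"
      by simp
  qed
  finally have "0 \<le> of_nat (card G) * s" .
  moreover have "card G > 0" using fin G.one_closed card_gt_0_iff by blast
  ultimately show ?thesis
    unfolding s_def[symmetric] by (auto simp: less_eq_complex_def zero_le_mult_iff)
qed

section \<open>Inclusion-exclusion for sums of matrices\<close>

lemma index_finsum_mat:
  fixes A :: "'b \<Rightarrow> 'a :: comm_ring_1 mat"
  assumes "finite I" "\<And>k. k \<in> I \<Longrightarrow> A k \<in> carrier_mat nr nc" "i < nr" "j < nc"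
  shows "finsum (module_mat TYPE('a) nr nc) A I $$ (i, j) = (\<Sum>k\<in>I. A k $$ (i, j))"
  using assms(1,2)
proof (induction I rule: finite_induct)
  interpret abelian_group "module_mat TYPE('a) nr nc" by (rule abelian_group_mat)
  {
    case empty
    then show ?case using assms(3,4) by (simp add: module_mat_simps)
  next
    case (insert k I)
    have "finsum (module_mat TYPE('a) nr nc) A I \<in> carrier_mat nr nc"
      using finsum_closed[of A I] insert.prems by (auto simp: module_mat_simps)
    moreover have "finsum (module_mat TYPE('a) nr nc) A (insert k I)
        = A k + finsum (module_mat TYPE('a) nr nc) A I"
      using finsum_insert[OF insert.hyps, of A] insert.prems by (auto simp: module_mat_simps)
    ultimately show ?case
      using insert assms(3,4) by simp
  }
qed

lemma gen_matrix_function_finsum: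
  assumes G: "G \<subseteq> {\<sigma>. \<sigma> permutes {1..m}}"
    and I: "finite I" "\<And>k. k \<in> I \<Longrightarrow> A k \<in> carrier_mat m m"
  shows "gen_matrix_function m G \<chi> (finsum (module_mat TYPE(complex) m m) A I)
       = (\<Sum>f \<in> {1..m} \<rightarrow>\<^sub>E I. \<Sum>\<sigma>\<in>G. \<chi> \<sigma> * (\<Prod>i=1..m. A (f i) $$ (i - 1, \<sigma> i - 1)))"
proof -
  have "(\<Prod>i=1..m. finsum (module_mat TYPE(complex) m m) A I $$ (i - 1, \<sigma> i - 1))
      = (\<Sum>f \<in> {1..m} \<rightarrow>\<^sub>E I. \<Prod>i=1..m. A (f i) $$ (i - 1, \<sigma> i - 1))" if "\<sigma> \<in> G" for \<sigma>
  proof -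
    have \<sigma>: "\<sigma> i \<in> {1..m}" if "i \<in> {1..m}" for i
      using subsetD[OF G \<open>\<sigma> \<in> G\<close>] that by (simp only: mem_Collect_eq permutes_in_image)
    have "(\<Prod>i=1..m. finsum (module_mat TYPE(complex) m m) A I $$ (i - 1, \<sigma> i - 1))
        = (\<Prod>i=1..m. \<Sum>k\<in>I. A k $$ (i - 1, \<sigma> i - 1))"
      using \<sigma> I by (intro prod.cong refl index_finsum_mat) force+
    also have "\<dots> = (\<Sum>f \<in> {1..m} \<rightarrow>\<^sub>E I. \<Prod>i=1..m. A (f i) $$ (i - 1, \<sigma> i - 1))"
      using I(1) by (intro prod_sum_PiE) auto
    finally show ?thesis .
  qed
  then show ?thesis
    unfolding gen_matrix_function_def
    by (subst sum.swap) (simp add: sum_distrib_left)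
qed

text \<open>The sum is the expansion of \<open>\<Prod>j\<in>N. 1 - (if j \<in> R then 0 else 1)\<close>, in which \<open>I\<close> is the set of
indices \<open>j\<close> where the summand \<open>1\<close> is chosen.\<close>

lemma alternating_sum_supersets:
  assumes "finite N" "R \<subseteq> N"
  shows "(\<Sum>I\<in>Pow N. (-1) ^ (card N - card I) * (if R \<subseteq> I then 1 else 0))
       = (if R = N then 1 else 0 :: complex)"
proof -
  have "(if R = N then 1 else 0 :: complex) = (\<Prod>j\<in>N. 1 - (if j \<in> R then 0 else 1))"
    using assms by (auto simp: prod_zero_iff)
  also have "\<dots> = (\<Sum>I\<in>Pow N. (-1) ^ (card N - card I) * (\<Prod>j\<in>I. 1)
      * (\<Prod>j\<in>N-I. if j \<in> R then 0 else 1))"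
    by (rule prod_diff_conv_sum'[OF assms(1)])
  also have "\<dots> = (\<Sum>I\<in>Pow N. (-1) ^ (card N - card I) * (if R \<subseteq> I then 1 else 0))"
    using assms by (intro sum.cong) (auto simp: prod_zero_iff finite_subset intro!: prod.neutral)
  finally show ?thesis by simp
qed

lemma alternating_sum_PiE:
  fixes g :: "('a \<Rightarrow> 'b) \<Rightarrow> complex"
  assumes "finite J" "finite N"
  shows "(\<Sum>I\<in>Pow N. (-1) ^ (card N - card I) * (\<Sum>f \<in> J \<rightarrow>\<^sub>E I. g f))
       = (\<Sum>f | f \<in> J \<rightarrow>\<^sub>E N \<and> f ` J = N. g f)"
proof -
  have fin: "finite (J \<rightarrow>\<^sub>E N)" using assms by (intro finite_PiE)
  have "(\<Sum>f \<in> J \<rightarrow>\<^sub>E I. g f) = (\<Sum>f \<in> J \<rightarrow>\<^sub>E N. (if f ` J \<subseteq> I then 1 else 0) * g f)"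
    if "I \<in> Pow N" for I
    using that fin by (intro sum.mono_neutral_cong_left) (auto simp: PiE_def Pi_def)
  then have "(\<Sum>I\<in>Pow N. (-1) ^ (card N - card I) * (\<Sum>f \<in> J \<rightarrow>\<^sub>E I. g f))
      = (\<Sum>I\<in>Pow N. \<Sum>f \<in> J \<rightarrow>\<^sub>E N. (-1) ^ (card N - card I) * (if f ` J \<subseteq> I then 1 else 0) * g f)"
    by (simp add: sum_distrib_left mult.assoc)
  also have "\<dots> = (\<Sum>f \<in> J \<rightarrow>\<^sub>E N.
      (\<Sum>I\<in>Pow N. (-1) ^ (card N - card I) * (if f ` J \<subseteq> I then 1 else 0)) * g f)"
    by (subst sum.swap) (simp add: sum_distrib_right)
  also have "\<dots> = (\<Sum>f \<in> J \<rightarrow>\<^sub>E N. (if f ` J = N then 1 else 0) * g f)"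
    using assms(2) by (intro sum.cong refl arg_cong2[of _ _ _ _ "(*)"] alternating_sum_supersets) auto
  also have "\<dots> = (\<Sum>f | f \<in> J \<rightarrow>\<^sub>E N \<and> f ` J = N. g f)"
    using fin by (intro sum.mono_neutral_cong_right) auto
  finally show ?thesis .
qed

section \<open>The alternating inequality\<close>

lemma parity_sum_diff:
  fixes s :: "nat \<Rightarrow> complex"
  assumes "n \<ge> 1"
  shows "(\<Sum>k | k \<in> {1..n} \<and> k mod 2 = n mod 2. s k)
       - (\<Sum>k | k \<in> {1..n - 1} \<and> k mod 2 = (n - 1) mod 2. s k)
       = (\<Sum>k=1..n. (-1) ^ (n - k) * s k)"
proof -
  have sgn: "(-1) ^ (n - k) = (if k mod 2 = n mod 2 then 1 else - 1 :: complex)" if "k \<le> n" for k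
  proof -
    from that obtain j where j: "n = k + j" using le_Suc_ex by blast
    have "k mod 2 = (k + j) mod 2 \<longleftrightarrow> even j" by presburger
    then show ?thesis by (simp add: j minus_one_power_iff)
  qed
  have "k \<in> {1..n - 1} \<and> k mod 2 = (n - 1) mod 2 \<longleftrightarrow> k \<in> {1..n} \<and> k mod 2 \<noteq> n mod 2" for k
  proof -
    from assms obtain n' where "n = Suc n'" by (cases n) auto
    then show ?thesis
      unfolding atLeastAtMost_iff by (simp only: diff_Suc_1) presburger
  qed
  then have "(\<Sum>k | k \<in> {1..n - 1} \<and> k mod 2 = (n - 1) mod 2. s k)
      = (\<Sum>k | k \<in> {1..n} \<and> k mod 2 \<noteq> n mod 2. s k)"
    by (simp only:)
  also have "\<dots> = (\<Sum>k=1..n. if k mod 2 \<noteq> n mod 2 then s k else 0)"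
    by (rule sum.inter_filter) simp
  finally have odd: "(\<Sum>k | k \<in> {1..n - 1} \<and> k mod 2 = (n - 1) mod 2. s k)
      = (\<Sum>k=1..n. if k mod 2 \<noteq> n mod 2 then s k else 0)" .
  have even: "(\<Sum>k | k \<in> {1..n} \<and> k mod 2 = n mod 2. s k)
      = (\<Sum>k=1..n. if k mod 2 = n mod 2 then s k else 0)"
    by (rule sum.inter_filter) simp
  show ?thesis
    unfolding odd even sum_subtractf[symmetric]
    by (intro sum.cong refl) (simp add: sgn)
qed

theorem corollary3p5:
  fixes m n :: nat
    and G :: "(nat \<Rightarrow> nat) set"
    and \<chi> :: "(nat \<Rightarrow> nat) \<Rightarrow> complex"
    and A :: "nat \<Rightarrow> complex mat"
    and s :: "nat \<Rightarrow> complex"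
  assumes "m \<ge> 1" and "n \<ge> 3"
    and "subgroup G (sym_group m)"
    and "irreducible_character ((sym_group m)\<lparr>carrier := G\<rparr>) \<chi>"
    and "\<And>i. i \<in> {1..n} \<Longrightarrow> hermitian_psd m (A i)"
    and "\<And>k. k \<in> {1..n} \<Longrightarrow> s k = subset_sum_function m G \<chi> n A k"
  shows "(\<Sum>k | k \<in> {1..n} \<and> k mod 2 = n mod 2. s k)
       \<ge> (\<Sum>k | k \<in> {1..n - 1} \<and> k mod 2 = (n - 1) mod 2. s k)"
proof -
  let ?N = "{1..n}"
  define D where "D I = gen_matrix_function m G \<chi> (finsum (module_mat TYPE(complex) m m) A I)" for I
  define g where "g f = (\<Sum>\<sigma>\<in>G. \<chi> \<sigma> * (\<Prod>i=1..m. A (f i) $$ (i - 1, \<sigma> i - 1)))" for f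
  let ?F = "{f. f \<in> {1..m} \<rightarrow>\<^sub>E ?N \<and> f ` {1..m} = ?N}"
  have perm: "\<tau> permutes {1..m}" if "\<tau> \<in> G" for \<tau>
    using subgroup.subset[OF assms(3)] that by (auto simp: sym_group_carrier)
  have carrier: "A k \<in> carrier_mat m m" if "k \<in> ?N" for k
    using assms(5)[OF that] by (simp add: hermitian_psd_def)
  have D: "D I = (\<Sum>f \<in> {1..m} \<rightarrow>\<^sub>E I. g f)" if "I \<in> Pow ?N" for I
    unfolding D_def g_def
    using that carrier perm
    by (intro gen_matrix_function_finsum) (auto intro: finite_subset)
  have D0: "D {} = 0"
  proof -
    have "1 \<in> {1..m}" using assms(1) by simp
    then have "{1..m} \<rightarrow>\<^sub>E ({} :: nat set) = {}" by blast
    with D[of "{}"] show ?thesis by simp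
  qed
  have "(\<Sum>k=1..n. (-1) ^ (n - k) * s k)
      = (\<Sum>k=1..n. \<Sum>I | I \<in> Pow ?N \<and> card I = k. (-1) ^ (n - card I) * D I)"
    using assms(6) by (intro sum.cong) (auto simp: subset_sum_function_def D_def sum_distrib_left)
  also have "\<dots> = (\<Sum>k\<in>{0..n}. \<Sum>I | I \<in> Pow ?N \<and> card I = k. (-1) ^ (n - card I) * D I)"
  proof (rule sum.mono_neutral_left)
    have "{I. I \<in> Pow ?N \<and> card I = 0} = {{}}"
      by (auto dest: finite_subset)
    then have "(\<Sum>I | I \<in> Pow ?N \<and> card I = 0. (-1) ^ (n - card I) * D I) = 0"
      by (simp only:) (simp add: D0)
    moreover have "k = 0" if "k \<in> {0..n} - {1..n}" for k
      using that by (cases k) auto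
    ultimately show "\<forall>k\<in>{0..n} - {1..n}. (\<Sum>I | I \<in> Pow ?N \<and> card I = k. (-1) ^ (n - card I) * D I) = 0"
      by blast
  qed auto
  also have "\<dots> = (\<Sum>I\<in>Pow ?N. (-1) ^ (card ?N - card I) * D I)"
  proof -
    have "card ` Pow ?N \<subseteq> {0..n}"
      using card_mono[of ?N] by force
    then show ?thesis
      using sum.group[of "Pow ?N" "{0..n}" card "\<lambda>I. (-1) ^ (n - card I) * D I"] by simp
  qed
  also have "\<dots> = (\<Sum>I\<in>Pow ?N. (-1) ^ (card ?N - card I) * (\<Sum>f \<in> {1..m} \<rightarrow>\<^sub>E I. g f))"
    by (intro sum.cong refl) (simp only: D)
  also have "\<dots> = (\<Sum>f\<in>?F. g f)"
    by (rule alternating_sum_PiE) simp_all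
  also have "\<dots> \<ge> 0"
    unfolding g_def
  proof (rule sum_positive_definite_function_nonneg[OF assms(3) irreducible_character_pos_kernel[OF assms(3,4)]])
    show "finite ?F"
      by (rule finite_subset[of _ "{1..m} \<rightarrow>\<^sub>E ?N"]) (auto intro: finite_PiE)
    show "f \<circ> \<tau> \<in> ?F" if "f \<in> ?F" "\<tau> \<in> G" for f \<tau>
    proof -
      note \<tau> = perm[OF that(2)]
      from that(1) have f: "f \<in> {1..m} \<rightarrow>\<^sub>E ?N" "f ` {1..m} = ?N" by simp_all
      have "f \<circ> \<tau> \<in> {1..m} \<rightarrow>\<^sub>E ?N"
      proof (rule PiE_I)
        show "(f \<circ> \<tau>) i \<in> ?N" if "i \<in> {1..m}" for i
          using PiE_mem[OF f(1), of "\<tau> i"] that by (simp only: comp_apply permutes_in_image[OF \<tau>])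
        show "(f \<circ> \<tau>) i = undefined" if "i \<notin> {1..m}" for i
          using PiE_arb[OF f(1) that] permutes_not_in[OF \<tau> that] by (simp only: comp_apply)
      qed
      moreover have "(f \<circ> \<tau>) ` {1..m} = ?N"
        by (simp only: image_comp[symmetric] permutes_image[OF \<tau>] f(2))
      ultimately show ?thesis by simp
    qed
    show "pos_kernel {1..m} (\<lambda>i j. A (f l) $$ (i - 1, j - 1))" if "f \<in> ?F" "l \<in> {1..m}" for f l
      using PiE_mem[of f "{1..m}" "\<lambda>_. ?N" l] that assms(5) by (intro hermitian_psd_pos_kernel) simp
  qed
  finally have "0 \<le> (\<Sum>k=1..n. (-1) ^ (n - k) * s k)" .
  moreover have "n \<ge> 1" using assms(2) by simp
  ultimately have "0 \<le> (\<Sum>k | k \<in> {1..n} \<and> k mod 2 = n mod 2. s k)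
      - (\<Sum>k | k \<in> {1..n - 1} \<and> k mod 2 = (n - 1) mod 2. s k)"
    by (simp only: parity_sum_diff)
  then show ?thesis
    by (simp only: diff_ge_0_iff_ge)
qed

end
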